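(* Let $\mathbf S=(S,+,0,\delta)$ be a weak contact semilattice. The following are equivalent: (1) $\mathbf S$ can be embedded into the $\{\delta,+\}$-reduct of a weak contact Boolean algebra; (2) $\mathbf S$ can be embedded into the $\{\delta,+\}$-reduct of a weak contact distributive lattice; (3) $\mathbf S$ satisfies (D1): for all $a,b,c_0,c_1\in S$, if $c_0\,\delta\, c_1$ fails, $b\leq a+c_0$ and $b\leq a+c_1$, then $b\leq a$; (4) $\mathbf S$ can be embedded into the $\{\delta,+\}$-reduct of a weak contact complete atomic Boolean algebra.
   Context: All posets/semilattices/lattices have a minimum $0$; semilattices are join semilattices. A weak contact relation on a poset $\mathbf P$ with $0$ is a symmetric, reflexive binary relation $\delta$ on $P\setminus\{0\}$ (so $0$ is related to nothing) such that if $a\,\delta\, b$, $a\leq a_1$, $b\leq b_1$ then $a_1\,\delta\, b_1$. A weak contact semilattice is a join semilattice with $0$ together with a weak contact relation (with respect to its order); similarly, a weak contact Boolean algebra (distributive lattice) is a Boolean algebra (distributive lattice with $0$) with a weak contact relation. An embedding is an injective map preserving $+$ and $0$ such that $a\,\delta\, b$ iff the images are $\delta$-related. *)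

theory Defs
  imports "HOL-Algebra.Complete_Lattice"
begin

text \<open>
  Ordered structures are the carrier-based ones of \<^theory>\<open>HOL-Algebra.Complete_Lattice\<close>,
  extended by one binary relation. The semilattice operation \<open>+\<close> is the join
  \<open>\<squnion>\<close> of the order, and \<open>0\<close> is \<open>\<bottom>\<close>.
\<close>

record 'a contact_order = "'a gorder" +
  contact :: "'a \<Rightarrow> 'a \<Rightarrow> bool" (infix \<open>\<delta>\<index>\<close> 50)

locale weak_contact_poset = partial_order P + weak_partial_order_bottom P
  for P :: "('a, 'm) contact_order_scheme" (structure) +
  assumes contact_nonzero:
      "x \<delta> y \<Longrightarrow> x \<in> carrier P - {\<bottom>} \<and> y \<in> carrier P - {\<bottom>}"
    and contact_refl: "x \<in> carrier P - {\<bottom>} \<Longrightarrow> x \<delta> x"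
    and contact_sym: "x \<delta> y \<Longrightarrow> y \<delta> x"
    and contact_mono:
      "\<lbrakk>x \<delta> y; x \<sqsubseteq> x'; y \<sqsubseteq> y'; x' \<in> carrier P; y' \<in> carrier P\<rbrakk> \<Longrightarrow> x' \<delta> y'"

locale weak_contact_semilattice = upper_semilattice S + weak_contact_poset S
  for S :: "('a, 'm) contact_order_scheme" (structure)

locale distributive_lattice = lattice L for L (structure) +
  assumes meet_join_distrib:
    "\<lbrakk>x \<in> carrier L; y \<in> carrier L; z \<in> carrier L\<rbrakk>
      \<Longrightarrow> x \<sqinter> (y \<squnion> z) = (x \<sqinter> y) \<squnion> (x \<sqinter> z)"

text \<open>The one-element Boolean algebra is allowed.\<close>

locale boolean_lattice = distributive_lattice L + bounded_lattice L for L (structure) +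
  assumes complement_exists:
    "x \<in> carrier L \<Longrightarrow> \<exists>y\<in>carrier L. x \<sqinter> y = \<bottom> \<and> x \<squnion> y = \<top>"

definition atom :: "('a, 'm) gorder_scheme \<Rightarrow> 'a \<Rightarrow> bool" where
  "atom L p \<longleftrightarrow> p \<in> carrier L \<and> p \<noteq> \<bottom>\<^bsub>L\<^esub> \<and>
     (\<forall>x\<in>carrier L. x \<sqsubseteq>\<^bsub>L\<^esub> p \<longrightarrow> x = \<bottom>\<^bsub>L\<^esub> \<or> x = p)"

locale complete_atomic_boolean_lattice = boolean_lattice L + complete_lattice L
  for L (structure) +
  assumes atomic: "\<lbrakk>x \<in> carrier L; x \<noteq> \<bottom>\<rbrakk> \<Longrightarrow> \<exists>p. atom L p \<and> p \<sqsubseteq> x"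

locale weak_contact_distributive_lattice = distributive_lattice L + weak_contact_poset L
  for L :: "('a, 'm) contact_order_scheme" (structure)

locale weak_contact_boolean_algebra = boolean_lattice L + weak_contact_poset L
  for L :: "('a, 'm) contact_order_scheme" (structure)

locale weak_contact_complete_atomic_boolean_algebra =
  complete_atomic_boolean_lattice L + weak_contact_poset L
  for L :: "('a, 'm) contact_order_scheme" (structure)

text \<open>
  Only \<open>\<squnion>\<close>, \<open>\<bottom>\<close> and \<open>\<delta>\<close> of the target are involved, so for a target with
  further operations this is an embedding into its reduct.
\<close>

definition contact_embedding ::
    "('a, 'm) contact_order_scheme \<Rightarrow> ('b, 'n) contact_order_scheme \<Rightarrow> ('a \<Rightarrow> 'b) \<Rightarrow> bool"
  where
  "contact_embedding S T h \<longleftrightarrow>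
     h \<in> carrier S \<rightarrow> carrier T \<and> inj_on h (carrier S) \<and>
     (\<forall>x\<in>carrier S. \<forall>y\<in>carrier S. h (x \<squnion>\<^bsub>S\<^esub> y) = h x \<squnion>\<^bsub>T\<^esub> h y) \<and>
     h \<bottom>\<^bsub>S\<^esub> = \<bottom>\<^bsub>T\<^esub> \<and>
     (\<forall>x\<in>carrier S. \<forall>y\<in>carrier S. x \<delta>\<^bsub>S\<^esub> y \<longleftrightarrow> h x \<delta>\<^bsub>T\<^esub> h y)"

text \<open>
  HOL cannot quantify over types inside a formula, so the type from which the elements
  of the target structure are taken is a parameter of the embeddability predicates. For a
  semilattice over \<open>'a\<close>, embeddability into some structure over any type at all amounts to
  embeddability into one over \<open>'a set set\<close>; the theorem asserts this reduction, so stating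
  the equivalences at \<open>'a set set\<close> loses nothing.
\<close>

definition embeds_in_boolean :: "'b itself \<Rightarrow> ('a, 'm) contact_order_scheme \<Rightarrow> bool" where
  "embeds_in_boolean _ S \<longleftrightarrow>
     (\<exists>(B :: 'b contact_order) h. weak_contact_boolean_algebra B \<and> contact_embedding S B h)"

definition embeds_in_distributive :: "'b itself \<Rightarrow> ('a, 'm) contact_order_scheme \<Rightarrow> bool" where
  "embeds_in_distributive _ S \<longleftrightarrow>
     (\<exists>(D :: 'b contact_order) h. weak_contact_distributive_lattice D \<and> contact_embedding S D h)"

definition embeds_in_complete_atomic_boolean ::
    "'b itself \<Rightarrow> ('a, 'm) contact_order_scheme \<Rightarrow> bool" where
  "embeds_in_complete_atomic_boolean _ S \<longleftrightarrow>
     (\<exists>(B :: 'b contact_order) h.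
        weak_contact_complete_atomic_boolean_algebra B \<and> contact_embedding S B h)"

definition D1 :: "('a, 'm) contact_order_scheme \<Rightarrow> bool" where
  "D1 S \<longleftrightarrow>
     (\<forall>a\<in>carrier S. \<forall>b\<in>carrier S. \<forall>c0\<in>carrier S. \<forall>c1\<in>carrier S.
        \<not> c0 \<delta>\<^bsub>S\<^esub> c1 \<and> b \<sqsubseteq>\<^bsub>S\<^esub> a \<squnion>\<^bsub>S\<^esub> c0 \<and> b \<sqsubseteq>\<^bsub>S\<^esub> a \<squnion>\<^bsub>S\<^esub> c1 \<longrightarrow> b \<sqsubseteq>\<^bsub>S\<^esub> a)"

end

theory Submission
  imports Defs
begin

text \<open>
  In a distributive lattice, elements that are not in contact have meet \<open>\<bottom>\<close>, because a common
  lower bound \<open>d \<noteq> \<bottom>\<close> satisfies \<open>d \<delta> d\<close>; hence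
  \<open>b \<sqsubseteq> (a \<squnion> c0) \<sqinter> (a \<squnion> c1) = a \<squnion> (c0 \<sqinter> c1) = a\<close>, and (D1) passes to subsemilattices.

  Conversely, call an ideal a contact ideal if any two elements outside it are in contact.
  If \<open>b\<close> is not below \<open>a\<close>, an ideal maximal among those containing \<open>a\<close> but not \<open>b\<close> is a
  contact ideal by (D1). So mapping \<open>x\<close> to the set of contact ideals that omit \<open>x\<close> embeds the
  semilattice into the powerset of the set of all contact ideals, and elements that are not in
  contact have disjoint images. This allows the powerset to carry the least weak contact
  relation that contains the image of \<open>\<delta>\<close>.
\<close>

section \<open>Ideals and the target structure\<close>

definition join_ideals :: "('a, 'm) gorder_scheme \<Rightarrow> 'a set set" where
  "join_ideals S = {I. I \<subseteq> carrier S \<and> \<bottom>\<^bsub>S\<^esub> \<in> I \<and>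
     (\<forall>x\<in>carrier S. \<forall>y\<in>I. x \<sqsubseteq>\<^bsub>S\<^esub> y \<longrightarrow> x \<in> I) \<and>
     (\<forall>x\<in>I. \<forall>y\<in>I. x \<squnion>\<^bsub>S\<^esub> y \<in> I)}"

text \<open>Complements of these ideals are the clans known from contact algebras: upward closed
  sets of pairwise contacting elements that contain \<open>x\<close> or \<open>y\<close> whenever
  they contain \<open>x \<squnion> y\<close>. The empty clan, with the whole carrier as its ideal,
  is included.\<close>

definition contact_ideals :: "('a, 'm) contact_order_scheme \<Rightarrow> 'a set set" where
  "contact_ideals S = {I \<in> join_ideals S. \<forall>x\<in>carrier S - I. \<forall>y\<in>carrier S - I. x \<delta>\<^bsub>S\<^esub> y}"

definition omitting :: "('a, 'm) contact_order_scheme \<Rightarrow> 'a \<Rightarrow> 'a set set" where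
  "omitting S x = {I \<in> contact_ideals S. x \<notin> I}"

text \<open>The relation is a parameter so that the lattice facts can be settled once for every
  \<open>R\<close>.\<close>

definition powerset_contact :: "'a set \<Rightarrow> ('a set \<Rightarrow> 'a set \<Rightarrow> bool) \<Rightarrow> 'a set contact_order" where
  "powerset_contact X R = \<lparr>carrier = Pow X, eq = (=), le = (\<subseteq>), contact = R\<rparr>"

text \<open>Overlap has to count as contact: a nonempty common part is in contact with itself, and
  monotonicity passes this to \<open>A\<close> and \<open>B\<close>. The other disjunct is the
  upward closure of the image of \<delta> under \<open>h\<close>.\<close>

definition generated_contact ::
    "'a set \<Rightarrow> ('b, 'm) contact_order_scheme \<Rightarrow> ('b \<Rightarrow> 'a set) \<Rightarrow> 'a set \<Rightarrow> 'a set \<Rightarrow> bool" where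
  "generated_contact X S h A B \<longleftrightarrow> A \<subseteq> X \<and> B \<subseteq> X \<and>
     (A \<inter> B \<noteq> {} \<or> (\<exists>x y. x \<delta>\<^bsub>S\<^esub> y \<and> h x \<subseteq> A \<and> h y \<subseteq> B))"

section \<open>Powersets as weak contact complete atomic Boolean algebras\<close>

lemma powerset_contact_simps [simp]:
  "carrier (powerset_contact X R) = Pow X"
  "eq (powerset_contact X R) = (=)"
  "le (powerset_contact X R) = (\<subseteq>)"
  "contact (powerset_contact X R) = R"
  by (simp_all add: powerset_contact_def)

lemma complete_lattice_powerset_contact: "complete_lattice (powerset_contact X R)"
proof (rule partial_order.complete_latticeI)
  show "partial_order (powerset_contact X R)"
    by standard auto
  fix A
  assume A: "A \<subseteq> carrier (powerset_contact X R)"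
  then have "least (powerset_contact X R) (\<Union>A) (Upper (powerset_contact X R) A)"
    by (fastforce simp: least_def Upper_def)
  then show "\<exists>s. least (powerset_contact X R) s (Upper (powerset_contact X R) A)" ..
  \<comment> \<open>Intersecting with \<open>X\<close> covers the empty family, where
    \<open>\<Inter>A\<close> is the universe of the type and the infimum must be
    \<open>X\<close>.\<close>
  from A have "greatest (powerset_contact X R) (\<Inter>A \<inter> X) (Lower (powerset_contact X R) A)"
    by (fastforce simp: greatest_def Lower_def)
  then show "\<exists>i. greatest (powerset_contact X R) i (Lower (powerset_contact X R) A)" ..
qed

lemma powerset_contact_join:
  assumes "A \<subseteq> X" "B \<subseteq> X"
  shows "A \<squnion>\<^bsub>powerset_contact X R\<^esub> B = A \<union> B"
proof -
  interpret complete_lattice "powerset_contact X R"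
    by (rule complete_lattice_powerset_contact)
  show ?thesis
    using assms join_left[of A B] join_right[of A B] join_le[of A "A \<union> B" B] by auto
qed

lemma powerset_contact_meet:
  assumes "A \<subseteq> X" "B \<subseteq> X"
  shows "A \<sqinter>\<^bsub>powerset_contact X R\<^esub> B = A \<inter> B"
proof -
  interpret complete_lattice "powerset_contact X R"
    by (rule complete_lattice_powerset_contact)
  have "A \<inter> B \<subseteq> X"
    using assms by blast
  then show ?thesis
    using assms meet_left[of A B] meet_right[of A B] meet_le[of "A \<inter> B" A B] by auto
qed

lemma powerset_contact_bottom: "\<bottom>\<^bsub>powerset_contact X R\<^esub> = {}"
proof -
  interpret complete_lattice "powerset_contact X R"
    by (rule complete_lattice_powerset_contact)
  show ?thesis
    using bottom_lower[of "{}"] by simp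
qed

lemma powerset_contact_top: "\<top>\<^bsub>powerset_contact X R\<^esub> = X"
proof -
  interpret complete_lattice "powerset_contact X R"
    by (rule complete_lattice_powerset_contact)
  show ?thesis
    using top_higher[of X] top_closed by auto
qed

lemma complete_atomic_boolean_lattice_powerset_contact:
  "complete_atomic_boolean_lattice (powerset_contact X R)"
proof -
  interpret complete_lattice "powerset_contact X R"
    by (rule complete_lattice_powerset_contact)
  show ?thesis
  proof unfold_locales
    fix A B C
    assume "A \<in> carrier (powerset_contact X R)" "B \<in> carrier (powerset_contact X R)"
      "C \<in> carrier (powerset_contact X R)"
    moreover from this have "A \<inter> B \<subseteq> X" "A \<inter> C \<subseteq> X" "B \<union> C \<subseteq> X"
      by auto
    ultimately show "A \<sqinter>\<^bsub>powerset_contact X R\<^esub> (B \<squnion>\<^bsub>powerset_contact X R\<^esub> C) =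
        (A \<sqinter>\<^bsub>powerset_contact X R\<^esub> B) \<squnion>\<^bsub>powerset_contact X R\<^esub> (A \<sqinter>\<^bsub>powerset_contact X R\<^esub> C)"
      by (simp add: powerset_contact_join powerset_contact_meet Int_Un_distrib)
  next
    fix A
    assume A: "A \<in> carrier (powerset_contact X R)"
    show "\<exists>B\<in>carrier (powerset_contact X R).
        A \<sqinter>\<^bsub>powerset_contact X R\<^esub> B = \<bottom>\<^bsub>powerset_contact X R\<^esub> \<and>
        A \<squnion>\<^bsub>powerset_contact X R\<^esub> B = \<top>\<^bsub>powerset_contact X R\<^esub>"
      using A by (intro bexI[of _ "X - A"])
        (auto simp: powerset_contact_join powerset_contact_meet powerset_contact_bottom
          powerset_contact_top)
    assume "A \<noteq> \<bottom>\<^bsub>powerset_contact X R\<^esub>"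
    then obtain p where "p \<in> A"
      by (auto simp: powerset_contact_bottom)
    with A show "\<exists>P. atom (powerset_contact X R) P \<and> P \<sqsubseteq>\<^bsub>powerset_contact X R\<^esub> A"
      by (intro exI[of _ "{p}"]) (auto simp: atom_def powerset_contact_bottom)
  qed
qed

text \<open>Nonempty images keep \<open>{}\<close> out of contact. Overlap yields reflexivity,
  symmetry comes from that of \<delta>, and both disjuncts of the generated relation are stable
  under enlarging the two sets.\<close>

lemma (in weak_contact_poset) weak_contact_complete_atomic_boolean_algebra_powerset:
  assumes "\<And>x. x \<in> carrier P - {\<bottom>} \<Longrightarrow> h x \<noteq> {}"
  shows "weak_contact_complete_atomic_boolean_algebra
    (powerset_contact X (generated_contact X P h))"
proof -
  let ?B = "powerset_contact X (generated_contact X P h)"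
  interpret B: complete_atomic_boolean_lattice ?B
    by (rule complete_atomic_boolean_lattice_powerset_contact)
  show ?thesis
  proof unfold_locales
    fix A B
    assume AB: "A \<delta>\<^bsub>?B\<^esub> B"
    show "A \<in> carrier ?B - {\<bottom>\<^bsub>?B\<^esub>} \<and> B \<in> carrier ?B - {\<bottom>\<^bsub>?B\<^esub>}"
      using AB assms contact_nonzero
      by (fastforce simp: generated_contact_def powerset_contact_bottom)
    show "B \<delta>\<^bsub>?B\<^esub> A"
      using AB contact_sym by (auto simp: generated_contact_def)
    fix A' B'
    assume "A \<sqsubseteq>\<^bsub>?B\<^esub> A'" "B \<sqsubseteq>\<^bsub>?B\<^esub> B'" "A' \<in> carrier ?B" "B' \<in> carrier ?B"
    then show "A' \<delta>\<^bsub>?B\<^esub> B'"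
      using AB unfolding generated_contact_def powerset_contact_simps
      by (meson PowD disjoint_iff subset_iff)
  next
    fix A
    assume "A \<in> carrier ?B - {\<bottom>\<^bsub>?B\<^esub>}"
    then show "A \<delta>\<^bsub>?B\<^esub> A"
      by (auto simp: generated_contact_def powerset_contact_bottom)
  qed
qed

section \<open>Necessity of (D1)\<close>

lemma (in upper_semilattice) le_iff_join_eq:
  assumes "x \<in> carrier L" "y \<in> carrier L"
  shows "x \<sqsubseteq> y \<longleftrightarrow> x \<squnion> y = y"
  using assms by (metis join_closed join_le join_left join_right le_refl le_antisym)

lemma (in upper_semilattice) join_mono:
  assumes "x \<sqsubseteq> x'" "y \<sqsubseteq> y'"
    and "x \<in> carrier L" "y \<in> carrier L" "x' \<in> carrier L" "y' \<in> carrier L"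
  shows "x \<squnion> y \<sqsubseteq> x' \<squnion> y'"
  using assms by (meson join_closed join_le join_left join_right le_trans)

lemma (in weak_contact_poset) contact_if_common_lower_bound:
  assumes "x \<in> carrier P - {\<bottom>}" "x \<sqsubseteq> y" "x \<sqsubseteq> z" "y \<in> carrier P" "z \<in> carrier P"
  shows "y \<delta> z"
  using assms contact_refl contact_mono by blast

lemma (in weak_contact_distributive_lattice) D1: "D1 L"
  unfolding D1_def
proof (intro ballI impI, elim conjE)
  fix a b c0 c1
  assume carr: "a \<in> carrier L" "b \<in> carrier L" "c0 \<in> carrier L" "c1 \<in> carrier L"
    and nc: "\<not> c0 \<delta> c1" and b0: "b \<sqsubseteq> a \<squnion> c0" and b1: "b \<sqsubseteq> a \<squnion> c1"
  \<comment> \<open>Only the law for meet over join is assumed, so it is applied twice in place of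
    its dual: first to \<open>d \<sqsubseteq> a \<squnion> c1\<close>, where
    \<open>d \<sqinter> c1\<close> vanishes and \<open>d \<sqsubseteq> a\<close> results, then to
    \<open>b \<sqsubseteq> a \<squnion> c0\<close>, which gives
    \<open>b = (b \<sqinter> a) \<squnion> d\<close>.\<close>
  define d where "d = b \<sqinter> c0"
  have d: "d \<in> carrier L" "d \<sqsubseteq> b" "d \<sqsubseteq> c0"
    using carr by (auto simp: d_def meet_left meet_right)
  have "d \<sqinter> c1 \<sqsubseteq> c0"
    using d carr by (meson le_trans meet_closed meet_left)
  then have "d \<sqinter> c1 = \<bottom>"
    using contact_if_common_lower_bound[of "d \<sqinter> c1" c0 c1] nc d carr meet_right by auto
  moreover have "d \<sqsubseteq> a \<squnion> c1"
    using d b1 carr by (meson join_closed le_trans)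
  then have "d = (d \<sqinter> a) \<squnion> (d \<sqinter> c1)"
    using d carr meet_join_distrib[of d a c1] le_iff_join[of d "a \<squnion> c1"] by simp
  moreover have "(d \<sqinter> a) \<squnion> \<bottom> \<sqsubseteq> a"
    using d carr by (intro join_le) (auto simp: meet_right)
  ultimately have "d \<sqsubseteq> a"
    by simp
  moreover have "b = (b \<sqinter> a) \<squnion> d"
    using carr b0 meet_join_distrib[of b a c0] le_iff_join[of b "a \<squnion> c0"] by (simp add: d_def)
  ultimately show "b \<sqsubseteq> a"
    using carr d join_le[of "b \<sqinter> a" a d] by (simp add: meet_right)
qed

text \<open>(D1) is a universal condition on join, order and contact, so substructures inherit it
  once the embedding is known to preserve and reflect the order.\<close>

lemma D1_contact_embedding:
  assumes "upper_semilattice S" "upper_semilattice T" "contact_embedding S T h" "D1 T"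
  shows "D1 S"
proof -
  interpret S: upper_semilattice S by fact
  interpret T: upper_semilattice T by fact
  have carr: "h x \<in> carrier T" if "x \<in> carrier S" for x
    using assms(3) that by (auto simp: contact_embedding_def)
  have join: "h (x \<squnion>\<^bsub>S\<^esub> y) = h x \<squnion>\<^bsub>T\<^esub> h y" if "x \<in> carrier S" "y \<in> carrier S" for x y
    using assms(3) that by (auto simp: contact_embedding_def)
  have contact: "x \<delta>\<^bsub>S\<^esub> y \<longleftrightarrow> h x \<delta>\<^bsub>T\<^esub> h y" if "x \<in> carrier S" "y \<in> carrier S" for x y
    using assms(3) that by (auto simp: contact_embedding_def)
  have inj: "inj_on h (carrier S)"
    using assms(3) by (simp add: contact_embedding_def)
  \<comment> \<open>The order is the equation \<open>x \<squnion> y = y\<close>, which an injective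
    join homomorphism preserves and reflects.\<close>
  have le: "x \<sqsubseteq>\<^bsub>S\<^esub> y \<longleftrightarrow> h x \<sqsubseteq>\<^bsub>T\<^esub> h y" if "x \<in> carrier S" "y \<in> carrier S" for x y
    using that carr inj_onD[OF inj, of "x \<squnion>\<^bsub>S\<^esub> y" y]
    by (metis join S.join_closed S.le_iff_join_eq T.le_iff_join_eq)
  show ?thesis
    unfolding D1_def
  proof (intro ballI impI, elim conjE)
    fix a b c0 c1
    assume S: "a \<in> carrier S" "b \<in> carrier S" "c0 \<in> carrier S" "c1 \<in> carrier S"
      and "\<not> c0 \<delta>\<^bsub>S\<^esub> c1" "b \<sqsubseteq>\<^bsub>S\<^esub> a \<squnion>\<^bsub>S\<^esub> c0" "b \<sqsubseteq>\<^bsub>S\<^esub> a \<squnion>\<^bsub>S\<^esub> c1"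
    then have "\<not> h c0 \<delta>\<^bsub>T\<^esub> h c1" "h b \<sqsubseteq>\<^bsub>T\<^esub> h a \<squnion>\<^bsub>T\<^esub> h c0" "h b \<sqsubseteq>\<^bsub>T\<^esub> h a \<squnion>\<^bsub>T\<^esub> h c1"
      by (simp_all add: le contact join)
    then have "h b \<sqsubseteq>\<^bsub>T\<^esub> h a"
      using assms(4)[unfolded D1_def, rule_format, of "h a" "h b" "h c0" "h c1"] S carr by simp
    then show "b \<sqsubseteq>\<^bsub>S\<^esub> a"
      using S le by blast
  qed
qed

lemma embeds_in_distributive_imp_D1:
  assumes "weak_contact_semilattice S" "embeds_in_distributive TYPE('b) S"
  shows "D1 S"
proof -
  interpret S: weak_contact_semilattice S by fact
  obtain D :: "'b contact_order" and h
    where D: "weak_contact_distributive_lattice D" and h: "contact_embedding S D h"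
    using assms(2) by (auto simp: embeds_in_distributive_def)
  interpret D: weak_contact_distributive_lattice D by fact
  show ?thesis
    using D1_contact_embedding[OF S.upper_semilattice_axioms D.upper_semilattice_axioms h D.D1] .
qed

section \<open>Join ideals and separation by contact ideals\<close>

context weak_contact_semilattice
begin

lemma join_idealsD:
  assumes "I \<in> join_ideals S"
  shows "I \<subseteq> carrier S" "\<bottom> \<in> I"
    and "\<And>x y. x \<in> carrier S \<Longrightarrow> y \<in> I \<Longrightarrow> x \<sqsubseteq> y \<Longrightarrow> x \<in> I"
    and "\<And>x y. x \<in> I \<Longrightarrow> y \<in> I \<Longrightarrow> x \<squnion> y \<in> I"
  using assms by (auto simp: join_ideals_def)

text \<open>Read for complements, this is why \<open>omitting\<close> turns joins into
  unions.\<close>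

lemma join_mem_ideal_iff:
  assumes "I \<in> join_ideals S" "x \<in> carrier S" "y \<in> carrier S"
  shows "x \<squnion> y \<in> I \<longleftrightarrow> x \<in> I \<and> y \<in> I"
  using assms join_idealsD[OF assms(1)] by (meson join_left join_right)

lemma principal_join_ideal:
  assumes "a \<in> carrier S"
  shows "{x \<in> carrier S. x \<sqsubseteq> a} \<in> join_ideals S"
  using assms unfolding join_ideals_def by (auto intro: join_le le_trans)

text \<open>This is the ideal generated by \<open>I\<close> and \<open>c\<close>. Two bounds
  \<open>i \<squnion> c\<close> and \<open>j \<squnion> c\<close> have the common bound
  \<open>(i \<squnion> j) \<squnion> c\<close> of the same form.\<close>

lemma join_ideal_adjoin:
  assumes I: "I \<in> join_ideals S" and c: "c \<in> carrier S"
  shows "{x \<in> carrier S. \<exists>i\<in>I. x \<sqsubseteq> i \<squnion> c} \<in> join_ideals S" (is "?J \<in> _")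
proof -
  note I = join_idealsD[OF I]
  have "\<bottom> \<in> ?J"
    using I c by (auto intro!: bexI[of _ \<bottom>])
  moreover have "x \<in> ?J" if "x \<in> carrier S" "y \<in> ?J" "x \<sqsubseteq> y" for x y
    using that I(1) c by (blast intro: le_trans join_closed)
  moreover have "x \<squnion> y \<in> ?J" if xy: "x \<in> ?J" "y \<in> ?J" for x y
  proof -
    obtain i j where ij: "i \<in> I" "x \<sqsubseteq> i \<squnion> c" "j \<in> I" "y \<sqsubseteq> j \<squnion> c"
      using xy by blast
    have carr: "i \<in> carrier S" "j \<in> carrier S" "x \<in> carrier S" "y \<in> carrier S"
      using I(1) ij xy by auto
    have "i \<squnion> c \<sqsubseteq> (i \<squnion> j) \<squnion> c" "j \<squnion> c \<sqsubseteq> (i \<squnion> j) \<squnion> c"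
      using carr c by (auto intro!: join_mono join_left join_right)
    then have "x \<squnion> y \<sqsubseteq> (i \<squnion> j) \<squnion> c"
      using ij carr c by (meson join_closed join_le le_trans)
    then show ?thesis
      using carr I(4) ij by auto
  qed
  ultimately show ?thesis
    unfolding join_ideals_def by blast
qed

text \<open>Any two elements of the union lie in a common member of the chain; a nonempty chain is
  required to supply \<open>\<bottom>\<close>.\<close>

lemma Union_chain_join_ideals:
  assumes C: "subset.chain (join_ideals S) C" and "C \<noteq> {}"
  shows "\<Union>C \<in> join_ideals S"
proof -
  have C_ideal: "I \<in> join_ideals S" if "I \<in> C" for I
    using C that by (auto simp: subset_chain_def)
  have "x \<squnion> y \<in> \<Union>C" if xy: "x \<in> \<Union>C" "y \<in> \<Union>C" for x y
  proof -
    obtain I J where IJ: "I \<in> C" "x \<in> I" "J \<in> C" "y \<in> J"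
      using xy by blast
    then have "I \<subseteq> J \<or> J \<subseteq> I"
      using C by (simp add: subset_chain_def)
    then show ?thesis
      using IJ join_idealsD(4)[OF C_ideal] by blast
  qed
  moreover have "\<bottom> \<in> \<Union>C"
    using assms(2) C_ideal join_idealsD(2) by blast
  moreover have "\<Union>C \<subseteq> carrier S"
    using join_idealsD(1)[OF C_ideal] by blast
  moreover have "x \<in> \<Union>C" if "x \<in> carrier S" "y \<in> \<Union>C" "x \<sqsubseteq> y" for x y
    using that join_idealsD(3)[OF C_ideal] by blast
  ultimately show ?thesis
    unfolding join_ideals_def by blast
qed

lemma contact_ideal_separation:
  assumes D1: "D1 S" and a: "a \<in> carrier S" and b: "b \<in> carrier S" and ab: "\<not> b \<sqsubseteq> a"
  obtains I where "I \<in> contact_ideals S" "a \<in> I" "b \<notin> I"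
proof -
  define F where "F = {I \<in> join_ideals S. a \<in> I \<and> b \<notin> I}"
  have "{x \<in> carrier S. x \<sqsubseteq> a} \<in> F"
    using a ab principal_join_ideal by (auto simp: F_def)
  then have "F \<noteq> {}"
    by blast
  moreover have "\<Union>C \<in> F" if C: "C \<noteq> {}" "subset.chain F C" for C
  proof -
    have "subset.chain (join_ideals S) C"
      using C by (auto simp: subset_chain_def F_def)
    then show ?thesis
      using C Union_chain_join_ideals by (auto simp: subset_chain_def F_def)
  qed
  ultimately obtain M where M: "M \<in> F" and max: "\<And>J. J \<in> F \<Longrightarrow> M \<subseteq> J \<Longrightarrow> J = M"
    using subset_Zorn_nonempty[of F] by blast
  have Mi: "M \<in> join_ideals S" and aM: "a \<in> M" and bM: "b \<notin> M"
    using M by (auto simp: F_def)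
  note M = join_idealsD[OF Mi]
  \<comment> \<open>Otherwise the ideal generated by \<open>M\<close> and \<open>c\<close> would
    still omit \<open>b\<close>, against the maximality of \<open>M\<close>.\<close>
  have ex: "\<exists>i\<in>M. b \<sqsubseteq> i \<squnion> c" if c: "c \<in> carrier S - M" for c
  proof (rule ccontr)
    let ?J = "{x \<in> carrier S. \<exists>i\<in>M. x \<sqsubseteq> i \<squnion> c}"
    assume "\<not> ?thesis"
    moreover have MJ: "M \<subseteq> ?J"
      using M(1) c join_left by blast
    moreover have "?J \<in> join_ideals S"
      using join_ideal_adjoin[OF Mi] c by blast
    ultimately have "?J \<in> F"
      using aM by (auto simp: F_def)
    then have "?J = M"
      using max MJ by blast
    moreover have "c \<in> ?J"
      using c M(1,2) by (auto intro!: bexI[of _ \<bottom>] join_right)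
    ultimately show False
      using c by blast
  qed
  have "c0 \<delta> c1" if c: "c0 \<in> carrier S - M" "c1 \<in> carrier S - M" for c0 c1
  proof (rule ccontr)
    assume nc: "\<not> c0 \<delta> c1"
    obtain i j where ij: "i \<in> M" "b \<sqsubseteq> i \<squnion> c0" "j \<in> M" "b \<sqsubseteq> j \<squnion> c1"
      using ex c by meson
    then have carr: "i \<in> carrier S" "j \<in> carrier S" "c0 \<in> carrier S" "c1 \<in> carrier S"
      using M(1) c by auto
    \<comment> \<open>(D1) needs one and the same element in both bounds;
      \<open>i \<squnion> j\<close> serves, and it stays in \<open>M\<close>, so that
      \<open>b \<sqsubseteq> i \<squnion> j\<close> contradicts \<open>b \<notin> M\<close>.\<close>
    then have "i \<squnion> c0 \<sqsubseteq> (i \<squnion> j) \<squnion> c0" "j \<squnion> c1 \<sqsubseteq> (i \<squnion> j) \<squnion> c1"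
      by (auto intro!: join_mono join_left join_right)
    then have "b \<sqsubseteq> (i \<squnion> j) \<squnion> c0" "b \<sqsubseteq> (i \<squnion> j) \<squnion> c1"
      using ij carr b by (meson join_closed le_trans)+
    then have "b \<sqsubseteq> i \<squnion> j"
      using D1 nc carr b unfolding D1_def by (meson join_closed)
    then show False
      using M(3,4) ij b bM by blast
  qed
  then have "M \<in> contact_ideals S"
    using Mi by (simp add: contact_ideals_def)
  then show ?thesis
    using that aM bM by blast
qed

section \<open>Representation by contact ideals\<close>

lemma omitting_join:
  assumes "x \<in> carrier S" "y \<in> carrier S"
  shows "omitting S (x \<squnion> y) = omitting S x \<union> omitting S y"
  using assms join_mem_ideal_iff by (auto simp: omitting_def contact_ideals_def)

lemma omitting_bottom: "omitting S \<bottom> = {}"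
  using join_idealsD(2) by (auto simp: omitting_def contact_ideals_def)

text \<open>Downward closure of ideals preserves the order, and separation reflects it: a contact
  ideal containing \<open>y\<close> but not \<open>x\<close> refutes the inclusion.\<close>

lemma omitting_subset_iff:
  assumes "D1 S" "x \<in> carrier S" "y \<in> carrier S"
  shows "omitting S x \<subseteq> omitting S y \<longleftrightarrow> x \<sqsubseteq> y"
proof
  assume sub: "omitting S x \<subseteq> omitting S y"
  show "x \<sqsubseteq> y"
  proof (rule ccontr)
    assume "\<not> x \<sqsubseteq> y"
    then obtain I where "I \<in> contact_ideals S" "y \<in> I" "x \<notin> I"
      using contact_ideal_separation assms by blast
    then show False
      using sub by (auto simp: omitting_def)
  qed
next
  assume "x \<sqsubseteq> y"
  then show "omitting S x \<subseteq> omitting S y"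
    using assms join_idealsD(3) by (auto simp: omitting_def contact_ideals_def)
qed

text \<open>Generation creates no new contact between images. An ideal common to both images omits
  \<open>x\<close> and \<open>y\<close>, which are then in contact by the definition of contact
  ideals; a contact lying below is pulled back along the reflected order and raised by
  monotonicity.\<close>

lemma contact_iff_generated_contact_omitting:
  assumes "D1 S" "x \<in> carrier S" "y \<in> carrier S"
  shows "x \<delta> y \<longleftrightarrow> generated_contact (contact_ideals S) S (omitting S) (omitting S x) (omitting S y)"
    (is "_ \<longleftrightarrow> ?G")
proof
  assume "x \<delta> y"
  then show ?G
    by (auto simp: generated_contact_def omitting_def)
next
  assume ?G
  then consider (meet) I where "I \<in> omitting S x" "I \<in> omitting S y"
    | (above) x' y' where "x' \<delta> y'" "omitting S x' \<subseteq> omitting S x" "omitting S y' \<subseteq> omitting S y"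
    by (auto simp: generated_contact_def)
  then show "x \<delta> y"
  proof cases
    case meet
    then show ?thesis
      using assms by (auto simp: omitting_def contact_ideals_def)
  next
    case above
    then show ?thesis
      using assms contact_nonzero[of x' y'] contact_mono[of x' y' x y] omitting_subset_iff by blast
  qed
qed

lemma D1_imp_embeds_in_complete_atomic_boolean:
  assumes D1: "D1 S"
  shows "embeds_in_complete_atomic_boolean TYPE('a set set) S"
proof -
  let ?B = "powerset_contact (contact_ideals S)
    (generated_contact (contact_ideals S) S (omitting S))"
  have inj: "x = y" if "x \<in> carrier S" "y \<in> carrier S" "omitting S x = omitting S y" for x y
    using that omitting_subset_iff[OF D1] by (metis le_antisym subset_refl)
  \<comment> \<open>Only \<open>\<bottom>\<close> can have the empty image, by injectivity.\<close>
  have "omitting S x \<noteq> {}" if "x \<in> carrier S - {\<bottom>}" for x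
    using that inj[of x \<bottom>] omitting_bottom by auto
  then have "weak_contact_complete_atomic_boolean_algebra ?B"
    by (rule weak_contact_complete_atomic_boolean_algebra_powerset)
  moreover have sub: "omitting S x \<subseteq> contact_ideals S" for x
    by (auto simp: omitting_def)
  then have "contact_embedding S ?B (omitting S)"
    using inj contact_iff_generated_contact_omitting[OF D1]
    by (auto simp: contact_embedding_def inj_on_def omitting_join powerset_contact_join
        omitting_bottom powerset_contact_bottom)
  ultimately show ?thesis
    unfolding embeds_in_complete_atomic_boolean_def by blast
qed

end

section \<open>Comparison of the embeddability conditions\<close>

lemma embeds_in_complete_atomic_boolean_imp_boolean:
  "embeds_in_complete_atomic_boolean TYPE('b) S \<Longrightarrow> embeds_in_boolean TYPE('b) S"
  unfolding embeds_in_complete_atomic_boolean_def embeds_in_boolean_def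
  by (meson complete_atomic_boolean_lattice.axioms(1) weak_contact_boolean_algebra.intro
      weak_contact_complete_atomic_boolean_algebra.axioms)

lemma embeds_in_boolean_imp_distributive:
  "embeds_in_boolean TYPE('b) S \<Longrightarrow> embeds_in_distributive TYPE('b) S"
  unfolding embeds_in_boolean_def embeds_in_distributive_def
  by (meson boolean_lattice.axioms(1) weak_contact_distributive_lattice.intro
      weak_contact_boolean_algebra.axioms)

theorem theorem3p1:
  fixes S :: "'a contact_order"
  assumes "weak_contact_semilattice S"
  shows
    "(embeds_in_boolean TYPE('a set set) S \<longleftrightarrow> embeds_in_distributive TYPE('a set set) S) \<and>
     (embeds_in_distributive TYPE('a set set) S \<longleftrightarrow> D1 S) \<and>
     (D1 S \<longleftrightarrow> embeds_in_complete_atomic_boolean TYPE('a set set) S) \<and>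
     (embeds_in_boolean TYPE('b) S \<longrightarrow> embeds_in_boolean TYPE('a set set) S) \<and>
     (embeds_in_distributive TYPE('b) S \<longrightarrow> embeds_in_distributive TYPE('a set set) S) \<and>
     (embeds_in_complete_atomic_boolean TYPE('b) S \<longrightarrow>
        embeds_in_complete_atomic_boolean TYPE('a set set) S)"
  \<comment> \<open>The implications form a cycle: (D1), complete atomic Boolean, Boolean,
    distributive, (D1). Embeddability at an arbitrary type \<open>'b\<close> also leads to (D1), and
    from there to the powerset of the contact ideals, whose elements have type
    \<open>'a set set\<close>.\<close>
  using weak_contact_semilattice.D1_imp_embeds_in_complete_atomic_boolean[OF assms]
    embeds_in_distributive_imp_D1[OF assms, where 'b = "'a set set"]
    embeds_in_distributive_imp_D1[OF assms, where 'b = 'b]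
    embeds_in_complete_atomic_boolean_imp_boolean[where S = S and 'b = "'a set set"]
    embeds_in_complete_atomic_boolean_imp_boolean[where S = S and 'b = 'b]
    embeds_in_boolean_imp_distributive[where S = S and 'b = "'a set set"]
    embeds_in_boolean_imp_distributive[where S = S and 'b = 'b]
  by blast

end
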